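(* Let $n,m,r$ be positive integers. The symmetric $3$-stage Clos network $C(n,m,r)$ is multirate wide-sense nonblocking if $m\ge 5.6355\,n+4$.
   Context: The symmetric $3$-stage Clos network $C(n,m,r)$ has $r$ input crossbars of size $n\times m$, $m$ middle crossbars of size $r\times r$, and $r$ output crossbars of size $m\times n$. Each input crossbar is joined by exactly one link to each middle crossbar, and each middle crossbar is joined by exactly one link to each output crossbar. The $rn$ inputs of the network are the inputs of the input crossbars ($n$ per crossbar) and the $rn$ outputs are the outputs of the output crossbars ($n$ per crossbar). Multirate environment: every input, every output and every internal link has capacity $1$. A request is a triple $(\mathbf a,\mathbf b,w)$ with $\mathbf a$ an input, $\mathbf b$ an output, and rate $w\in(0,1]$. At every time, the total rate of the present requests from any given input, and to any given output, is at most $1$; so if the existing requests use $x$ units of $\mathbf a$'s capacity and $y$ units of $\mathbf b$'s capacity, a new request $(\mathbf a,\mathbf b,w)$ must satisfy $w\le\min\{1-x,1-y\}$. A request is routed through a single middle crossbar $M$; it then uses rate $w$ on the link from the input crossbar containing $\mathbf a$ to $M$ and on the link from $M$ to the output crossbar containing $\mathbf b$. The total rate carried by each internal link must be at most $1$. Requests arrive and depart over time in arbitrary order. The network is multirate wide-sense nonblocking if there is a routing algorithm (deciding online, on the basis of past events, the middle crossbar for each arriving request) such that, when all requests are routed by this algorithm, every new request can always be routed without disturbing (rerouting) existing connections. *)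

theory Defs
  imports Complex_Main
begin

text \<open>
  Multirate traffic on the symmetric 3-stage Clos network \<open>C(n, m, r)\<close>. All crossbars and ports
  are numbered from 0. The port \<open>(i, a)\<close> with \<open>i < r\<close> and \<open>a < n\<close> is the \<open>a\<close>-th input
  (respectively output) of the \<open>i\<close>-th input (respectively output) crossbar.
\<close>

type_synonym port = "nat \<times> nat"

abbreviation crossbar :: "port \<Rightarrow> nat" where
  "crossbar \<equiv> fst"

definition ports :: "nat \<Rightarrow> nat \<Rightarrow> port set" where
  "ports n r = {..<r} \<times> {..<n}"

datatype request = Request (source: port) (target: port) (rate: real)

definition requests :: "nat \<Rightarrow> nat \<Rightarrow> request set" where
  "requests n r =
     {q. source q \<in> ports n r \<and> target q \<in> ports n r \<and> 0 < rate q \<and> rate q \<le> 1}"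

text \<open>
  A history is the list of past events, oldest first. Equal requests may coexist, so a connection
  is identified by the position of its arrival event in the history; \<open>Departure k\<close> ends the
  connection that arrived at position \<open>k\<close>.
\<close>

datatype event = Arrival (arriving: request) | Departure nat

type_synonym history = "event list"

definition present :: "history \<Rightarrow> nat set" where
  "present h = {k. k < length h \<and> is_Arrival (h ! k) \<and> Departure k \<notin> set h}"

definition input_load :: "history \<Rightarrow> port \<Rightarrow> real" where
  "input_load h a = (\<Sum>k | k \<in> present h \<and> source (arriving (h ! k)) = a. rate (arriving (h ! k)))"

definition output_load :: "history \<Rightarrow> port \<Rightarrow> real" where
  "output_load h b = (\<Sum>k | k \<in> present h \<and> target (arriving (h ! k)) = b. rate (arriving (h ! k)))"

inductive admissible :: "nat \<Rightarrow> nat \<Rightarrow> history \<Rightarrow> bool" for n r where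
  empty: "admissible n r []"
| arrival: "\<lbrakk>admissible n r h; q \<in> requests n r;
    rate q \<le> min (1 - input_load h (source q)) (1 - output_load h (target q))\<rbrakk>
    \<Longrightarrow> admissible n r (h @ [Arrival q])"
| departure: "\<lbrakk>admissible n r h; k \<in> present h\<rbrakk> \<Longrightarrow> admissible n r (h @ [Departure k])"

text \<open>
  \<open>First_Link i M\<close> joins input crossbar \<open>i\<close> to middle crossbar \<open>M\<close>, and \<open>Second_Link M j\<close> joins
  middle crossbar \<open>M\<close> to output crossbar \<open>j\<close>.
\<close>

datatype link = First_Link nat nat | Second_Link nat nat

definition route :: "request \<Rightarrow> nat \<Rightarrow> link set" where
  "route q M = {First_Link (crossbar (source q)) M, Second_Link M (crossbar (target q))}"

text \<open>
  A deterministic online algorithm maps the past events and the arriving request to a middle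
  crossbar. Its own earlier decisions need not be passed to it, as they are functions of the past
  events.
\<close>

type_synonym routing_algorithm = "history \<Rightarrow> request \<Rightarrow> nat"

text \<open>
  The middle crossbar of a connection depends only on the history up to its arrival, so connections
  are never rerouted.
\<close>

definition middle_of :: "routing_algorithm \<Rightarrow> history \<Rightarrow> nat \<Rightarrow> nat" where
  "middle_of A h k = A (take k h) (arriving (h ! k))"

definition link_load :: "routing_algorithm \<Rightarrow> history \<Rightarrow> link \<Rightarrow> real" where
  "link_load A h l =
     (\<Sum>k | k \<in> present h \<and> l \<in> route (arriving (h ! k)) (middle_of A h k). rate (arriving (h ! k)))"

definition multirate_wide_sense_nonblocking :: "nat \<Rightarrow> nat \<Rightarrow> nat \<Rightarrow> bool" where
  "multirate_wide_sense_nonblocking n m r \<longleftrightarrow>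
     (\<exists>A :: routing_algorithm. \<forall>h q. admissible n r (h @ [Arrival q]) \<longrightarrow>
        A h q < m \<and> (\<forall>l \<in> route q (A h q). link_load A h l + rate q \<le> 1))"

end

theory Submission imports Defs begin

text \<open>
  Connections of rate above \<open>1/2\<close> are routed by first fit on \<open>2n + 1\<close> reserved middle crossbars,
  the others by first fit on the remaining ones. A port carries at most one large connection, so at
  most \<open>2n\<close> reserved crossbars are blocked for a large request. A connection of rate \<open>s\<close> on the
  crossbar preceded by \<open>x\<close> crossbars of its group found all of those blocked, whence
  \<open>x (1 - s) \<le> 2n\<close>. A link blocked for a small request carries more than \<open>1/2\<close>, hence at least two
  small connections, and therefore at least \<open>2 - 4n/x\<close>. If all crossbars were blocked, the sum of
  \<open>max (1/2) (2 - 4n/x)\<close> over \<open>x\<close> would be at most the total load \<open>2n\<close> of the two outer crossbars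
  involved, which fails from about \<open>3.6005n\<close> crossbars on. Taking \<open>29n/8\<close> of them leaves enough
  slack to replace \<open>2 - 4n/x\<close> by its chord between \<open>8n/3\<close> and \<open>11n/3\<close>.
\<close>

section \<open>Admissible histories\<close>

lemma finite_present [simp]: "finite (present h)"
  by (rule finite_subset[of _ "{..<length h}"]) (auto simp: present_def)

lemma present_less_length: "k \<in> present h \<Longrightarrow> k < length h"
  by (simp add: present_def)

lemma admissible_butlast:
  assumes "admissible n r (h @ [e])"
  shows "admissible n r h"
  using assms by cases auto

lemma admissible_prefix: "admissible n r (h @ h') \<Longrightarrow> admissible n r h"
proof (induction h' rule: rev_induct)
  case (snoc e h')
  then show ?case
    using admissible_butlast[of n r "h @ h'" e] by simp
qed simp

lemma admissible_take: "admissible n r h \<Longrightarrow> admissible n r (take k h)"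
  using admissible_prefix[of n r "take k h" "drop k h"] by simp

lemma admissible_snoc_arrival:
  assumes "admissible n r (h @ [Arrival q])"
  shows "q \<in> requests n r"
  using assms by cases auto

text \<open>Lets every fact about an arriving request be applied afterwards to a present connection,
  in the history it met on arrival.\<close>

lemma admissible_at_arrival:
  assumes "admissible n r h" "k \<in> present h"
  shows "admissible n r (take k h @ [Arrival (arriving (h ! k))])"
proof -
  have "k < length h" "is_Arrival (h ! k)"
    using assms(2) by (auto simp: present_def)
  then have "take k h @ [Arrival (arriving (h ! k))] = take (Suc k) h"
    by (simp add: take_Suc_conv_app_nth)
  then show ?thesis
    using admissible_take[OF assms(1), of "Suc k"] by simp
qed

lemma present_in_requests:
  assumes "admissible n r h" "k \<in> present h"
  shows "arriving (h ! k) \<in> requests n r"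
  using admissible_at_arrival[OF assms] by (rule admissible_snoc_arrival)

lemma rate_present_pos:
  assumes "admissible n r h" "k \<in> present h"
  shows "0 < rate (arriving (h ! k))"
  using present_in_requests[OF assms] by (simp add: requests_def)

text \<open>The projection \<open>p\<close> is \<open>source\<close> or \<open>target\<close>, so
  that both sides of the network share one proof.\<close>

definition port_load :: "(request \<Rightarrow> port) \<Rightarrow> history \<Rightarrow> port \<Rightarrow> real" where
  "port_load p h a = (\<Sum>k | k \<in> present h \<and> p (arriving (h ! k)) = a. rate (arriving (h ! k)))"

lemma port_load_source: "port_load source = input_load"
  and port_load_target: "port_load target = output_load"
  by (auto simp: fun_eq_iff port_load_def input_load_def output_load_def)

lemma port_load_arrival:
  assumes "admissible n r h" "q \<in> requests n r"
  shows "port_load p (h @ [Arrival q]) a \<le> port_load p h a + (if p q = a then rate q else 0)"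
proof -
  let ?h = "h @ [Arrival q]"
  let ?S = "{k \<in> present h. p (arriving (h ! k)) = a}"
  let ?T = "if p q = a then {length h} else {}"
  let ?rt = "\<lambda>k. rate (arriving (?h ! k))"
  have "port_load p ?h a \<le> sum ?rt (?S \<union> ?T)"
    unfolding port_load_def
  proof (rule sum_mono2)
    show "{k \<in> present ?h. p (arriving (?h ! k)) = a} \<subseteq> ?S \<union> ?T"
      by (auto simp: present_def nth_append less_Suc_eq split: if_splits)
    fix k assume "k \<in> (?S \<union> ?T) - {k \<in> present ?h. p (arriving (?h ! k)) = a}"
    then show "0 \<le> ?rt k"
      using rate_present_pos[OF assms(1), of k] assms(2)
      by (auto simp: nth_append requests_def present_less_length less_imp_le split: if_splits)
  qed simp
  also have "\<dots> = sum ?rt ?S + sum ?rt ?T"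
    by (rule sum.union_disjoint) (auto dest: present_less_length)
  also have "sum ?rt ?S = port_load p h a"
    unfolding port_load_def
    by (rule sum.cong) (auto simp: nth_append dest: present_less_length)
  also have "sum ?rt ?T = (if p q = a then rate q else 0)"
    by simp
  finally show ?thesis .
qed

lemma port_load_departure:
  assumes "admissible n r h"
  shows "port_load p (h @ [Departure k]) a \<le> port_load p h a"
proof -
  have sub: "present (h @ [Departure k]) \<subseteq> present h"
    by (auto simp: present_def nth_append less_Suc_eq split: if_splits)
  have "port_load p (h @ [Departure k]) a
      = (\<Sum>j | j \<in> present (h @ [Departure k]) \<and> p (arriving (h ! j)) = a. rate (arriving (h ! j)))"
    unfolding port_load_def
    by (rule sum.cong) (use sub in \<open>auto simp: nth_append dest: present_less_length\<close>)
  also have "\<dots> \<le> port_load p h a"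
    unfolding port_load_def
    by (rule sum_mono2) (use sub rate_present_pos[OF assms] in \<open>auto intro: less_imp_le\<close>)
  finally show ?thesis .
qed

lemma port_load_le_1:
  assumes "admissible n r h" "p \<in> {source, target}"
  shows "port_load p h a \<le> 1"
  using assms
proof (induction arbitrary: a)
  case empty
  then show ?case by (simp add: port_load_def present_def)
next
  case (arrival h q)
  have "port_load p h (p q) + rate q \<le> 1"
    using arrival by (auto simp flip: port_load_source port_load_target)
  then show ?case
    using port_load_arrival[OF arrival(1,2), of p a] arrival.IH[OF arrival.prems, of a]
    by (auto split: if_splits)
next
  case (departure h k)
  then show ?case
    using port_load_departure[OF departure(1), of p k a] by (meson order_trans)
qed

section \<open>Loads of outer crossbars and links\<close>

lemma present_port_in_ports:
  assumes "admissible n r h" "p \<in> {source, target}" "k \<in> present h"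
  shows "p (arriving (h ! k)) \<in> ports n r"
  using present_in_requests[OF assms(1,3)] assms(2) by (auto simp: requests_def)

text \<open>The traffic of \<open>First_Link i M\<close> for \<open>source\<close>, of
  \<open>Second_Link M i\<close> for \<open>target\<close>.\<close>

definition trunk :: "routing_algorithm \<Rightarrow> history \<Rightarrow> (request \<Rightarrow> port) \<Rightarrow> nat \<Rightarrow> nat \<Rightarrow> nat set" where
  "trunk A h p i M =
     {k \<in> present h. crossbar (p (arriving (h ! k))) = i \<and> middle_of A h k = M}"

definition trunk_load :: "routing_algorithm \<Rightarrow> history \<Rightarrow> (request \<Rightarrow> port) \<Rightarrow> nat \<Rightarrow> nat \<Rightarrow> real" where
  "trunk_load A h p i M = (\<Sum>k\<in>trunk A h p i M. rate (arriving (h ! k)))"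

lemma finite_trunk [simp]: "finite (trunk A h p i M)"
  by (simp add: trunk_def)

lemma trunk_nonempty: "trunk_load A h p i M \<noteq> 0 \<Longrightarrow> \<exists>k. k \<in> trunk A h p i M"
  unfolding trunk_load_def by (cases "trunk A h p i M = {}") auto

lemma link_load_First: "link_load A h (First_Link i M) = trunk_load A h source i M"
  unfolding link_load_def trunk_load_def trunk_def route_def
  by (rule sum.cong) auto

lemma link_load_Second: "link_load A h (Second_Link M j) = trunk_load A h target j M"
  unfolding link_load_def trunk_load_def trunk_def route_def
  by (rule sum.cong) auto

lemma trunk_load_nonneg: "admissible n r h \<Longrightarrow> 0 \<le> trunk_load A h p i M"
  unfolding trunk_load_def trunk_def
  by (rule sum_nonneg) (auto dest: rate_present_pos)

text \<open>Trunks to different middle crossbars are disjoint, and all their connections use the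
  \<open>n\<close> ports of crossbar \<open>i\<close>, each loaded by at most 1.\<close>

lemma sum_trunk_load_le:
  assumes adm: "admissible n r h" and p: "p \<in> {source, target}" and X: "finite X"
  shows "(\<Sum>M\<in>X. trunk_load A h p i M) \<le> real n"
proof -
  let ?rt = "\<lambda>k. rate (arriving (h ! k))"
  let ?S = "{k \<in> present h. crossbar (p (arriving (h ! k))) = i}"
  let ?T = "\<lambda>a. {k \<in> present h. p (arriving (h ! k)) = (i, a)}"
  have pos: "0 \<le> ?rt k" if "k \<in> present h" for k
    using rate_present_pos[OF adm that] by simp
  have "(\<Sum>M\<in>X. trunk_load A h p i M) = sum ?rt (\<Union>M\<in>X. trunk A h p i M)"
    unfolding trunk_load_def
    by (rule sum.UNION_disjoint[symmetric]) (auto simp: X, auto simp: trunk_def)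
  also have "\<dots> \<le> sum ?rt (\<Union>a<n. ?T a)"
  proof (rule sum_mono2)
    show "(\<Union>M\<in>X. trunk A h p i M) \<subseteq> (\<Union>a<n. ?T a)"
    proof
      fix k assume "k \<in> (\<Union>M\<in>X. trunk A h p i M)"
      then have k: "k \<in> present h" "crossbar (p (arriving (h ! k))) = i"
        by (auto simp: trunk_def)
      then show "k \<in> (\<Union>a<n. ?T a)"
        using present_port_in_ports[OF adm p k(1)]
        by (cases "p (arriving (h ! k))") (auto simp: ports_def)
    qed
  qed (auto intro: pos)
  also have "\<dots> = (\<Sum>a<n. port_load p h (i, a))"
    unfolding port_load_def by (rule sum.UNION_disjoint) auto
  also have "\<dots> \<le> (\<Sum>a<n. 1)"
    by (intro sum_mono port_load_le_1[OF adm p])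
  finally show ?thesis by simp
qed

lemma two_members_le_sum:
  fixes f :: "'a \<Rightarrow> real"
  assumes "finite S" "x \<in> S" "y \<in> S" "x \<noteq> y" "\<And>z. z \<in> S \<Longrightarrow> 0 \<le> f z"
  shows "f x + f y \<le> sum f S"
  using sum_mono2[of S "{x, y}" f] assms by auto

lemma card_large_le:
  assumes adm: "admissible n r h" and p: "p \<in> {source, target}"
  shows "card {k \<in> present h. crossbar (p (arriving (h ! k))) = i \<and> 1/2 < rate (arriving (h ! k))} \<le> n"
    (is "card ?S \<le> n")
proof -
  let ?port = "\<lambda>k. p (arriving (h ! k))"
  have "inj_on ?port ?S"
  proof (rule inj_onI, rule ccontr)
    fix k k' assume k: "k \<in> ?S" "k' \<in> ?S" "?port k = ?port k'" "k \<noteq> k'"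
    have "rate (arriving (h ! k)) + rate (arriving (h ! k')) \<le> port_load p h (?port k)"
      unfolding port_load_def
      by (rule two_members_le_sum) (use k in \<open>auto dest: rate_present_pos[OF adm]\<close>)
    then show False
      using port_load_le_1[OF adm p, of "?port k"] k by simp
  qed
  moreover have "?port ` ?S \<subseteq> {i} \<times> {..<n}"
  proof
    fix a assume "a \<in> ?port ` ?S"
    then show "a \<in> {i} \<times> {..<n}"
      using present_port_in_ports[OF adm p] by (auto simp: ports_def mem_Times_iff)
  qed
  ultimately have "card ?S \<le> card ({i} \<times> {..<n})"
    by (intro card_inj_on_le) auto
  then show ?thesis by simp
qed

section \<open>First fit\<close>

definition admits :: "routing_algorithm \<Rightarrow> history \<Rightarrow> request \<Rightarrow> nat \<Rightarrow> bool" where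
  "admits A h q M \<longleftrightarrow> (\<forall>l\<in>route q M. link_load A h l + rate q \<le> 1)"

text \<open>The search starts at \<open>b q\<close> and has no upper end; that it stops early enough
  is proved from the traffic.\<close>

definition first_fit :: "(request \<Rightarrow> nat) \<Rightarrow> routing_algorithm \<Rightarrow> bool" where
  "first_fit b A \<longleftrightarrow> (\<forall>h q. A h q = (LEAST M. b q \<le> M \<and> admits A h q M))"

text \<open>\<open>first_fit\<close> is a fixed-point equation, since link loads depend on earlier
  decisions of \<open>A\<close> itself. Recursion on the length of the history solves it:
  \<open>D\<close> receives those decisions indexed by arrival position.\<close>

function online :: "((nat \<Rightarrow> nat) \<Rightarrow> history \<Rightarrow> request \<Rightarrow> nat) \<Rightarrow> routing_algorithm" where
  "online D h q =
     D (\<lambda>k. if k < length h then online D (take k h) (arriving (h ! k)) else 0) h q"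
  by pat_completeness auto
termination by (relation "measure (\<lambda>(D, h, q). length h)") auto

declare online.simps [simp del]

lemma ex_first_fit: "\<exists>A. first_fit b A"
proof -
  define L where "L c h l =
    (\<Sum>k | k \<in> present h \<and> l \<in> route (arriving (h ! k)) (c k). rate (arriving (h ! k)))"
    for c :: "nat \<Rightarrow> nat" and h l
  define D where "D c h q = (LEAST M. b q \<le> M \<and> (\<forall>l\<in>route q M. L c h l + rate q \<le> 1))"
    for c h q
  define A where "A = online D"
  \<comment> \<open>Loads consult only present positions, all below \<open>length h\<close>, so the
    default 0 is never read.\<close>
  have L: "L (\<lambda>k. if k < length h then A (take k h) (arriving (h ! k)) else 0) h l = link_load A h l"
    for h l
    unfolding L_def link_load_def middle_of_def
    by (rule sum.cong) (auto dest: present_less_length)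
  have "A h q = (LEAST M. b q \<le> M \<and> admits A h q M)" for h q
  proof -
    have "A h q = D (\<lambda>k. if k < length h then A (take k h) (arriving (h ! k)) else 0) h q"
      unfolding A_def by (rule online.simps)
    then show ?thesis
      by (simp add: D_def admits_def L)
  qed
  then show ?thesis by (auto simp: first_fit_def)
qed

lemma first_fit_found:
  assumes "first_fit b A" "b q \<le> M" "admits A h q M"
  shows "b q \<le> A h q \<and> admits A h q (A h q) \<and> A h q \<le> M"
proof -
  have A: "A h q = (LEAST M. b q \<le> M \<and> admits A h q M)"
    using assms(1) by (simp add: first_fit_def)
  show ?thesis
    unfolding A using LeastI[of "\<lambda>M. b q \<le> M \<and> admits A h q M" M]
      Least_le[of "\<lambda>M. b q \<le> M \<and> admits A h q M" M] assms by blast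
qed

lemma first_fit_skipped:
  assumes "first_fit b A" "b q \<le> M" "M < A h q"
  shows "\<not> admits A h q M"
proof -
  have A: "A h q = (LEAST M. b q \<le> M \<and> admits A h q M)"
    using assms(1) by (simp add: first_fit_def)
  show ?thesis
    using assms not_less_Least[of M "\<lambda>M. b q \<le> M \<and> admits A h q M"] unfolding A by blast
qed

lemma not_admits_iff:
  "\<not> admits A h q M \<longleftrightarrow>
     (\<exists>p\<in>{source, target}. 1 - rate q < trunk_load A h p (crossbar (p q)) M)"
  by (auto simp: admits_def route_def link_load_First link_load_Second)

text \<open>Each crossbar is charged to one of its two links towards the outer crossbars of
  \<open>q\<close>, and each of these two outer crossbars carries at most \<open>n\<close> in
  total.\<close>

lemma sum_blocked_le:
  assumes adm: "admissible n r h" and X: "finite X"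
    and f: "\<And>M. M \<in> X \<Longrightarrow> \<exists>p\<in>{source, target}. f M \<le> trunk_load A h p (crossbar (p q)) M"
  shows "sum f X \<le> 2 * real n"
proof -
  have "sum f X \<le> (\<Sum>M\<in>X. trunk_load A h source (crossbar (source q)) M
      + trunk_load A h target (crossbar (target q)) M)"
    using f trunk_load_nonneg[OF adm] by (intro sum_mono) (fastforce intro: add_increasing add_increasing2)
  also have "\<dots> \<le> real n + real n"
    unfolding sum.distrib by (intro add_mono sum_trunk_load_le[OF adm _ X]) auto
  finally show ?thesis by simp
qed

text \<open>Each skipped crossbar had a link loaded above \<open>1 - rate q\<close>. This holds even
  for a junk value of \<open>LEAST\<close>, as nothing below it can satisfy the predicate.\<close>

lemma first_fit_offset_le:
  assumes ff: "first_fit b A" and adm: "admissible n r h"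
  shows "real (A h q - b q) * (1 - rate q) \<le> 2 * real n"
proof -
  have "(\<Sum>M\<in>{b q..<A h q}. 1 - rate q) \<le> 2 * real n"
  proof (rule sum_blocked_le[OF adm])
    fix M assume "M \<in> {b q..<A h q}"
    then have "\<not> admits A h q M"
      by (intro first_fit_skipped[OF ff]) auto
    then show "\<exists>p\<in>{source, target}. 1 - rate q \<le> trunk_load A h p (crossbar (p q)) M"
      unfolding not_admits_iff by (meson less_imp_le)
  qed simp
  then show ?thesis by simp
qed

section \<open>Large requests\<close>

definition base :: "nat \<Rightarrow> request \<Rightarrow> nat" where
  "base n q = (if 1/2 < rate q then 0 else 2 * n + 1)"

text \<open>
  The assumption excludes the junk value of \<open>LEAST\<close> for small requests, which might
  otherwise lie among the reserved crossbars.
\<close>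

lemma ex_admits_large:
  assumes adm: "admissible n r h" and large: "1/2 < rate q" "rate q \<le> 1"
    and small: "\<And>k. k \<in> present h \<Longrightarrow> rate (arriving (h ! k)) \<le> 1/2 \<Longrightarrow> 2 * n < middle_of A h k"
  shows "\<exists>M\<le>2 * n. admits A h q M"
proof (rule ccontr)
  assume blocked: "\<not> ?thesis"
  define S where "S p = {k \<in> present h. crossbar (p (arriving (h ! k))) = crossbar (p q)
      \<and> 1/2 < rate (arriving (h ! k))}" for p
  \<comment> \<open>Pigeonhole: each of the \<open>2 * n + 1\<close> blocked crossbars would carry a
    large connection sharing an outer crossbar with \<open>q\<close>, and there are at most
    \<open>2 * n\<close> of these.\<close>
  have "{..2 * n} \<subseteq> middle_of A h ` (S source \<union> S target)"
  proof
    fix M assume "M \<in> {..2 * n}"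
    then have M: "M \<le> 2 * n" by simp
    then have "\<not> admits A h q M"
      using blocked by blast
    then obtain p where p: "p \<in> {source, target}"
        and "1 - rate q < trunk_load A h p (crossbar (p q)) M"
      unfolding not_admits_iff by blast
    then have "trunk_load A h p (crossbar (p q)) M \<noteq> 0"
      using large by simp
    then obtain k where "k \<in> trunk A h p (crossbar (p q)) M"
      using trunk_nonempty by blast
    then have k: "k \<in> present h" "crossbar (p (arriving (h ! k))) = crossbar (p q)"
        "middle_of A h k = M"
      by (auto simp: trunk_def)
    then have "1/2 < rate (arriving (h ! k))"
      using small[of k] M by force
    then have "k \<in> S p"
      using k by (simp add: S_def)
    then show "M \<in> middle_of A h ` (S source \<union> S target)"
      using p k(3) by auto
  qed
  moreover have fin: "finite (S p)" for p
    by (simp add: S_def)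
  ultimately have "card {..2 * n} \<le> card (S source \<union> S target)"
    by (meson finite_UnI surj_card_le)
  also have "\<dots> \<le> card (S source) + card (S target)"
    by (rule card_Un_le)
  also have "\<dots> \<le> n + n"
    unfolding S_def by (intro add_mono card_large_le[OF adm]) auto
  finally show False by simp
qed

section \<open>Small requests\<close>

text \<open>With \<open>t = real K - a\<close>, the left side is nonpositive for \<open>t\<close> in
  [0, 1] and grows by exactly the new summand \<open>t\<close> when \<open>K\<close> becomes
  \<open>Suc K\<close>.\<close>

lemma sum_positive_part_ge:
  fixes a :: real
  assumes "0 \<le> a" "a \<le> real K"
  shows "(real K - a) * (real K - a - 1) / 2 \<le> (\<Sum>x<K. max 0 (real x - a))"
  using assms
proof (induction K)
  case 0
  then show ?case by simp
next
  case (Suc K)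
  show ?case
  proof (cases "a \<le> real K")
    case True
    have "(real (Suc K) - a) * (real (Suc K) - a - 1) / 2
        = (real K - a) * (real K - a - 1) / 2 + (real K - a)"
      by (simp add: field_simps)
    then show ?thesis
      using Suc.IH[OF Suc.prems(1) True] True by simp
  next
    case False
    then have "(real (Suc K) - a) * (real (Suc K) - a - 1) / 2 \<le> 0"
      using Suc.prems by (simp add: mult_nonneg_nonpos)
    also have "0 \<le> (\<Sum>x<Suc K. max 0 (real x - a))"
      by (rule sum_nonneg) simp
    finally show ?thesis .
  qed
qed

text \<open>In terms of \<open>y = x/n\<close>, the function \<open>2 - 4/y\<close> is 1/2 at 8/3
  and 10/11 at 11/3; hence the slope 9/22 of the chord.\<close>

definition level_bound :: "nat \<Rightarrow> nat \<Rightarrow> real" where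
  "level_bound n x = 1/2 + 9/22 * max 0 (real x - 8/3 * real n) / real n"

text \<open>The right side is concave; its excess over the chord factors explicitly.\<close>

lemma chord_le:
  fixes y :: real
  assumes "8/3 \<le> y" "y \<le> 11/3"
  shows "1/2 + 9/22 * (y - 8/3) \<le> 2 * (1 - 2 / y)"
proof -
  have "0 \<le> 9/22 * ((y - 8/3) * (11/3 - y)) / y"
    using assms by simp
  also have "\<dots> = 2 * (1 - 2 / y) - (1/2 + 9/22 * (y - 8/3))"
    using assms by (simp add: field_simps)
  finally show ?thesis by simp
qed

text \<open>\<open>L\<close> stands for the load of a blocked link, \<open>s\<close> for a lower
  bound on the rates it carries.\<close>

lemma level_bound_le:
  assumes n: "0 < n" and x: "real x \<le> 11/3 * real n"
    and s: "real x * (1 - s) \<le> 2 * real n" and L: "1/2 \<le> L" "2 * s \<le> L"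
  shows "level_bound n x \<le> L"
proof (cases "real x \<le> 8/3 * real n")
  case True
  then show ?thesis using L by (simp add: level_bound_def)
next
  case False
  define y where "y = real x / real n"
  have y: "8/3 \<le> y" "y \<le> 11/3"
    using False x n by (auto simp: y_def field_simps)
  have "y * (1 - s) \<le> 2"
    using s n by (simp add: y_def field_simps)
  then have "1 - 2 / y \<le> s"
    using y by (simp add: field_simps)
  moreover have "level_bound n x = 1/2 + 9/22 * (y - 8/3)"
    using False n by (simp add: level_bound_def y_def field_simps)
  ultimately show ?thesis
    using chord_le[OF y] L by auto
qed

text \<open>The extra 1/2 is the contribution of one more blocked crossbar, at level
  \<open>K\<close>.\<close>

lemma sum_level_bound:
  assumes n: "0 < n" and K: "K = nat \<lceil>29/8 * real n\<rceil>"
  shows "2 * real n < (\<Sum>x<K. level_bound n x) + 1/2"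
proof -
  define N where "N = real n"
  define T where "T = real K - 8/3 * N"
  have N: "1 \<le> N" using n by (simp add: N_def)
  \<comment> \<open>Note 29/8 - 8/3 = 23/24, which bounds \<open>T\<close> below.\<close>
  have KN: "29/8 * N \<le> real K"
    unfolding K N_def by linarith
  then have T: "23/24 * N \<le> T"
    unfolding T_def by linarith
  have "23/24 * N * (23/24 * N - 1) \<le> T * (T - 1)"
  proof -
    have "0 \<le> (T - 23/24 * N) * (T + 23/24 * N - 1)"
      using T N by (intro mult_nonneg_nonneg) linarith+
    then show ?thesis by (simp add: algebra_simps)
  qed
  also have "T * (T - 1) \<le> 2 * (\<Sum>x<K. max 0 (real x - 8/3 * N))"
    using sum_positive_part_ge[of "8/3 * N" K] T N by (simp add: T_def)
  finally have *: "23/24 * N * (23/24 * N - 1) / 2 \<le> (\<Sum>x<K. max 0 (real x - 8/3 * N))"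
    by simp
  have "9/22 * (23/24 * (23/24 * N - 1) / 2) = 9/22 / N * (23/24 * N * (23/24 * N - 1) / 2)"
    using N by (simp add: field_simps)
  also have "\<dots> \<le> 9/22 / N * (\<Sum>x<K. max 0 (real x - 8/3 * N))"
    using N by (intro mult_left_mono[OF *]) simp
  also have "\<dots> = (\<Sum>x<K. level_bound n x) - real K / 2"
    unfolding level_bound_def sum.distrib N_def[symmetric]
    by (simp add: sum_distrib_left sum_divide_distrib)
  finally have "9/22 * (23/24 * (23/24 * N - 1) / 2) \<le> (\<Sum>x<K. level_bound n x) - real K / 2" .
  \<comment> \<open>The coefficient of \<open>N\<close> is 29/16 + 9/22 * (23/24)^2 / 2, about
    2.0004, just above 2; the constant lost, 9/22 * 23/48, is below 1/2.\<close>
  then show ?thesis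
    using KN N unfolding N_def[symmetric] by (simp add: field_simps)
qed

section \<open>Blocked crossbars of the small group\<close>

text \<open>One connection of rate at most 1/2 cannot produce a load above 1/2, so there are
  two.\<close>

lemma trunk_load_ge_two:
  assumes adm: "admissible n r h" and load: "1/2 < trunk_load A h p i M"
    and s: "\<And>k. k \<in> trunk A h p i M \<Longrightarrow> s \<le> rate (arriving (h ! k)) \<and> rate (arriving (h ! k)) \<le> 1/2"
  shows "2 * s \<le> trunk_load A h p i M"
proof -
  obtain k where k: "k \<in> trunk A h p i M"
    using load trunk_nonempty[of A h p i M] by auto
  have "trunk A h p i M \<noteq> {k}"
    using load s[OF k] unfolding trunk_load_def by auto
  then obtain k' where k': "k' \<in> trunk A h p i M" "k \<noteq> k'"
    using k by blast
  have "rate (arriving (h ! k)) + rate (arriving (h ! k')) \<le> trunk_load A h p i M"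
    unfolding trunk_load_def
    by (rule two_members_le_sum) (use k k' rate_present_pos[OF adm] in \<open>auto simp: trunk_def less_imp_le\<close>)
  then show ?thesis using s[OF k] s[OF k'(1)] by linarith
qed

lemma ex_admits_small:
  assumes n: "0 < n" and ff: "first_fit (base n) A"
    and adm: "admissible n r h" and q: "rate q \<le> 1/2"
    and large: "\<And>k. k \<in> present h \<Longrightarrow> 1/2 < rate (arriving (h ! k)) \<Longrightarrow> middle_of A h k \<le> 2 * n"
  shows "\<exists>M. 2 * n + 1 \<le> M \<and> M \<le> 2 * n + 1 + nat \<lceil>29/8 * real n\<rceil> \<and> admits A h q M"
proof (rule ccontr)
  assume none: "\<not> ?thesis"
  define K where "K = nat \<lceil>29/8 * real n\<rceil>"
  \<comment> \<open>Level \<open>K\<close> is credited with 1/2 only: being rounded up,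
    \<open>K\<close> can exceed 11n/3 (as for \<open>n = 1\<close>), where the chord bound
    fails.\<close>
  define f where "f x = (if x < K then level_bound n x else 1/2)" for x
  let ?b = "2 * n + 1"
  have blocked: "\<exists>p\<in>{source, target}. f (M - ?b) \<le> trunk_load A h p (crossbar (p q)) M"
    if M: "M \<in> {?b..?b + K}" for M
  proof -
    have "\<not> admits A h q M"
      using none M unfolding K_def by auto
    then obtain p where p: "p \<in> {source, target}"
        and "1 - rate q < trunk_load A h p (crossbar (p q)) M"
      unfolding not_admits_iff by blast
    then have load: "1/2 < trunk_load A h p (crossbar (p q)) M"
      using q by linarith
    have "f (M - ?b) \<le> trunk_load A h p (crossbar (p q)) M"
    proof (cases "M - ?b < K")
      case True
      define x where "x = M - ?b"
      have x: "real x \<le> 11/3 * real n"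
        using True unfolding x_def[symmetric] K_def by linarith
      \<comment> \<open>The solution of \<open>x * (1 - s) = 2 * n\<close>; level 0 gives no
        information beyond positivity of rates.\<close>
      define s where "s = (if x = 0 then 0 else 1 - 2 * real n / real x)"
      have "2 * s \<le> trunk_load A h p (crossbar (p q)) M"
      proof (rule trunk_load_ge_two[OF adm load])
        fix k assume "k \<in> trunk A h p (crossbar (p q)) M"
        then have k: "k \<in> present h" "A (take k h) (arriving (h ! k)) = M"
          by (auto simp: trunk_def middle_of_def)
        have half: "rate (arriving (h ! k)) \<le> 1/2"
          using large[OF k(1)] k(2) M by (force simp: middle_of_def)
        \<comment> \<open>The offset bound is applied in \<open>take k h\<close>, when the
          connection arrived; later departures do not affect it.\<close>
        have "real x * (1 - rate (arriving (h ! k))) \<le> 2 * real n"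
          using first_fit_offset_le[OF ff admissible_take[OF adm], of k "arriving (h ! k)"] k(2) half
          by (simp add: x_def base_def)
        then have "s \<le> rate (arriving (h ! k))"
          using rate_present_pos[OF adm k(1)] by (auto simp: s_def field_simps)
        then show "s \<le> rate (arriving (h ! k)) \<and> rate (arriving (h ! k)) \<le> 1/2"
          using half by simp
      qed
      then have "level_bound n x \<le> trunk_load A h p (crossbar (p q)) M"
        using load by (intro level_bound_le[OF n x, of s]) (auto simp: s_def)
      then show ?thesis
        using True by (simp add: f_def x_def)
    next
      case False
      then show ?thesis using load by (simp add: f_def)
    qed
    then show ?thesis using p by blast
  qed
  have "(\<Sum>x\<le>K. f x) = (\<Sum>M\<in>{?b..?b + K}. f (M - ?b))"
    by (rule sum.reindex_bij_witness[of _ "\<lambda>M. M - ?b" "\<lambda>x. x + ?b"]) auto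
  also have "\<dots> \<le> 2 * real n"
    by (rule sum_blocked_le[OF adm _ blocked]) auto
  finally have "(\<Sum>x\<le>K. f x) \<le> 2 * real n" .
  moreover have "(\<Sum>x\<le>K. f x) = (\<Sum>x<K. level_bound n x) + 1/2"
    by (simp add: f_def lessThan_Suc_atMost[symmetric])
  ultimately show False
    using sum_level_bound[OF n K_def] by simp
qed

section \<open>The routing invariant and the theorem\<close>

text \<open>Each class finds room only if the other stays in its own group. This separation for
  present connections is the claim itself at their earlier arrivals, hence induction on the length
  of the history.\<close>

lemma first_fit_routes:
  assumes n: "0 < n" and ff: "first_fit (base n) A" and adm: "admissible n r (h @ [Arrival q])"
  shows "admits A h q (A h q)
    \<and> (if 1/2 < rate q then A h q \<le> 2 * n
       else 2 * n + 1 \<le> A h q \<and> A h q \<le> 2 * n + 1 + nat \<lceil>29/8 * real n\<rceil>)"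
  using adm
proof (induction "length h" arbitrary: h q rule: less_induct)
  case less
  have adm: "admissible n r h"
    using less.prems by (rule admissible_butlast)
  have IH: "if 1/2 < rate (arriving (h ! k)) then middle_of A h k \<le> 2 * n
      else 2 * n < middle_of A h k" if "k \<in> present h" for k
    using less.hyps[OF _ admissible_at_arrival[OF adm that]] present_less_length[OF that]
    by (auto simp: middle_of_def split: if_splits)
  show ?case
  proof (cases "1/2 < rate q")
    case True
    have "rate q \<le> 1"
      using admissible_snoc_arrival[OF less.prems] by (simp add: requests_def)
    then obtain M where "M \<le> 2 * n" "admits A h q M"
      using ex_admits_large[OF adm True, of A] IH by (metis not_less)
    then show ?thesis
      using first_fit_found[OF ff, of q M h] True by (auto simp: base_def)
  next
    case False
    then obtain M where "2 * n + 1 \<le> M" "M \<le> 2 * n + 1 + nat \<lceil>29/8 * real n\<rceil>" "admits A h q M"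
      using ex_admits_small[OF n ff adm, of q] IH by (metis not_less)
    then show ?thesis
      using first_fit_found[OF ff, of q M h] False by (auto simp: base_def)
  qed
qed

theorem corollary3p5:
  fixes n m r :: nat
  assumes "n > 0" and "m > 0" and "r > 0"
    and "real m \<ge> 5.6355 * real n + 4"
  shows "multirate_wide_sense_nonblocking n m r"
proof -
  obtain A where A: "first_fit (base n) A"
    using ex_first_fit by blast
  \<comment> \<open>Rounding up adds less than 1, and 2 + 29/8 = 5.625 is below 5.6355.\<close>
  have m: "2 * n + 1 + nat \<lceil>29/8 * real n\<rceil> < m"
  proof -
    have "29/8 * real n + 2 * real n + 2 < real m"
      using assms(4) by simp
    then show ?thesis by linarith
  qed
  show ?thesis
    unfolding multirate_wide_sense_nonblocking_def
  proof (intro exI[of _ A] allI impI)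
    fix h q assume "admissible n r (h @ [Arrival q])"
    from first_fit_routes[OF assms(1) A this] m
    show "A h q < m \<and> (\<forall>l\<in>route q (A h q). link_load A h l + rate q \<le> 1)"
      by (auto simp: admits_def split: if_splits)
  qed
qed

end
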